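(* Let $\mathcal{E}^{\mathrm{trun}}_{\mathrm{mid}}(\boldsymbol r_i)$ be the error incurred in the mid-range potential $\Phi^{\mathrm{mid}}_{\mathrm{SOG}}(\boldsymbol r_i)$ when the Fourier sum/integral defining it is truncated to the modes $|\boldsymbol k|\le K^{\mathrm{mid}}_{\max}$. Under the Debye--H\"uckel (DH) assumption, the following estimate holds: $$\|\mathcal{E}^{\mathrm{trun}}_{\mathrm{mid}}\|_\infty=O\left(K^{\mathrm{mid}}_{\max}\,e^{-s_0^2(K^{\mathrm{mid}}_{\max})^2}\right).$$ To achieve a prescribed tolerance $\varepsilon$, we have $K^{\mathrm{mid}}_{\max}=O\left(\sqrt{\log(1/\varepsilon)}/s_0\right)$.
   Context: System: charges $q_1,\dots,q_N\in\mathbb R$ with $\sum_i q_i=0$ at positions $\boldsymbol r_i=(x_i,y_i,z_i)\in[-L_x/2,L_x/2]\times[-L_y/2,L_y/2]\times[-L_z/2,L_z/2]$, periodic in $x,y$ and free in $z$. Write $\boldsymbol r_{ij}=\boldsymbol r_i-\boldsymbol r_j$, $r_{ij}=|\boldsymbol r_{ij}|$, $\boldsymbol k=(\dot{\boldsymbol k},k_z)$, $k=|\boldsymbol k|$, $q_{\max}=\max_j|q_j|$, and $\|\cdot\|_\infty$ for the maximum over $i$. Let $\mathcal K^2=\frac{2\pi}{L_x}\mathbb Z\times\frac{2\pi}{L_y}\mathbb Z$ and $$\mathcal L[g(\boldsymbol k)]=\frac{1}{2\pi L_xL_y}\sum_{\dot{\boldsymbol k}\in\mathcal K^2}\int_{\mathbb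 R}g([\dot{\boldsymbol k},k_z])\,dk_z.$$ Sum-of-Gaussians (SOG) parameters: $b>1$, $\sigma>0$, $s_\ell=\sqrt2\,b^\ell\sigma$, $w_\ell=(\pi/2)^{-1/2}b^{-\ell}\sigma^{-1}\log b$ for $\ell\ge1$ and $w_0=\omega(\pi/2)^{-1/2}\sigma^{-1}\log b$, where $\omega$ is a parameter (close to 1) adjusting the weight of the narrowest Gaussian. The mid-range Gaussians are those with $0\le\ell\le m$, where $s_m\le\eta L_z<s_{m+1}$ for a fixed range-splitting factor $\eta>0$, $\eta=O(1)$. The mid-range potential is $$\Phi^{\mathrm{mid}}_{\mathrm{SOG}}(\boldsymbol r_i)=4\pi\sum_{j=1}^N q_j\,\mathcal L\left[\frac{\widehat\tau^{\mathrm{mid}}_{\mathrm{SOG}}(\boldsymbol k)}{k^2}e^{\mathrm i\boldsymbol k\cdot\boldsymbol r_{ij}}\right],\qquad \widehat\tau^{\mathrm{mid}}_{\mathrm{SOG}}(\boldsymbol k)=\frac{\sqrt\pi}{4}\sum_{\ell=0}^m w_\ell s_\ell^3k^2e^{-s_\ell^2k^2/4}.$$ DH assumption: the charges are distributed as in the Debye--H\"uckel theory of an electrolyte confined to the cell. The ions are hard spheres of diameter $a$ with charges $\pm q$ at their centers; around a fixed ion the potential $\phi$ satisfies $\Delta\phi=0$ for $0<r<a$ and the linearized Poisson--Boltzmann equation $\Delta\phi=\kappa^2\phi$ for $r\ge a$ ($\kappa$ the inverse Debye length), so that the net charge density for $r\ge a$ is $-\kappa^2\phi(r)$. The consequence used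 is that sums $\sum_j q_je^{\mathrm i\boldsymbol k\cdot\boldsymbol r_{ij}}G(r_{ij})$, with $G$ a radial function of at most polynomial growth, are bounded in absolute value by a constant (depending on $G$) times the charge magnitude; in particular $\left|\sum_jq_j\frac{\sin(kr_{ij})}{kr_{ij}}\right|\le Cq_{\max}$ with $C$ a constant. Standing approximation: in the error estimates the functional $\mathcal L$ is replaced by an integral, $\mathcal L[f]\approx(2\pi)^{-3}\int_{\mathbb R^3}f(\boldsymbol k)\,d\boldsymbol k$.
   Formalization: The rate is proved as O(K exp(-s_0^2 K^2/4)); the printed exponent -s_0^2 K^2 lacks the factor 1/4 and fails: for two opposite ions the non-oscillating self term j=i makes the error of exact order K exp(-s_0^2 K^2/4). *)

theory Defs
  imports "HOL-Analysis.Analysis"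
begin

section \<open>Sum-of-Gaussians parameters\<close>

definition sog_s :: "real \<Rightarrow> real \<Rightarrow> nat \<Rightarrow> real" where
  "sog_s b \<sigma> l = sqrt 2 * b ^ l * \<sigma>"

definition sog_w :: "real \<Rightarrow> real \<Rightarrow> real \<Rightarrow> nat \<Rightarrow> real" where
  "sog_w b \<sigma> \<omega> l =
     (if l = 0 then \<omega> * (pi / 2) powr (- 1 / 2) * inverse \<sigma> * ln b
      else (pi / 2) powr (- 1 / 2) * inverse (b ^ l) * inverse \<sigma> * ln b)"

definition tau_mid_hat :: "real \<Rightarrow> real \<Rightarrow> real \<Rightarrow> nat \<Rightarrow> real ^ 3 \<Rightarrow> real" where
  "tau_mid_hat b \<sigma> \<omega> m k =
     sqrt pi / 4 *
       (\<Sum>l\<le>m. sog_w b \<sigma> \<omega> l * sog_s b \<sigma> l ^ 3 * norm k ^ 2 *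
               exp (- (sog_s b \<sigma> l ^ 2 * norm k ^ 2 / 4)))"


section \<open>Fourier functionals\<close>

text \<open>
  The functional of the doubly periodic slab geometry: a sum over the in-plane reciprocal
  lattice, parametrised by pairs of integers, and an integral over the free direction.
\<close>

definition slab_functional :: "real \<Rightarrow> real \<Rightarrow> (real ^ 3 \<Rightarrow> complex) \<Rightarrow> complex" where
  "slab_functional Lx Ly g =
     complex_of_real (1 / (2 * pi * Lx * Ly)) *
       (\<Sum>\<^sub>\<infinity>(n1, n2) \<in> (UNIV :: (int \<times> int) set).
          \<integral>kz. g (vector [2 * pi / Lx * of_int n1, 2 * pi / Ly * of_int n2, kz]) \<partial>lborel)"

text \<open>The integral that replaces \<open>slab_functional\<close> in error estimates.\<close>

definition bulk_functional :: "(real ^ 3 \<Rightarrow> complex) \<Rightarrow> complex" where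
  "bulk_functional g = complex_of_real (1 / (2 * pi) ^ 3) * (\<integral>k. g k \<partial>lborel)"


section \<open>Mid-range potential and its truncation\<close>

text \<open>
  At \<open>k = 0\<close> the quotient below is \<open>0 / 0 = 0\<close> instead of its limit; a single point does not
  affect either functional.
\<close>

definition mid_mode ::
  "real \<Rightarrow> real \<Rightarrow> real \<Rightarrow> nat \<Rightarrow> real ^ 3 \<Rightarrow> real ^ 3 \<Rightarrow> complex" where
  "mid_mode b \<sigma> \<omega> m x k =
     complex_of_real (tau_mid_hat b \<sigma> \<omega> m k / norm k ^ 2) * exp (\<i> * complex_of_real (k \<bullet> x))"

text \<open>
  The potentials take the Fourier functional as their first argument: \<open>slab_functional Lx Ly\<close>
  gives the potential of the slab system, \<open>bulk_functional\<close> its approximation in error estimates.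
  Particles are numbered from 1 to N; the self term \<open>j = i\<close> is part of the sum.
\<close>

definition mid_potential ::
  "((real ^ 3 \<Rightarrow> complex) \<Rightarrow> complex) \<Rightarrow> real \<Rightarrow> real \<Rightarrow> real \<Rightarrow> nat \<Rightarrow>
   nat \<Rightarrow> (nat \<Rightarrow> real) \<Rightarrow> (nat \<Rightarrow> real ^ 3) \<Rightarrow> nat \<Rightarrow> complex" where
  "mid_potential L b \<sigma> \<omega> m N q r i =
     4 * complex_of_real pi *
       (\<Sum>j=1..N. complex_of_real (q j) * L (mid_mode b \<sigma> \<omega> m (r i - r j)))"

definition mid_potential_trunc ::
  "((real ^ 3 \<Rightarrow> complex) \<Rightarrow> complex) \<Rightarrow> real \<Rightarrow> real \<Rightarrow> real \<Rightarrow> nat \<Rightarrow> real \<Rightarrow>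
   nat \<Rightarrow> (nat \<Rightarrow> real) \<Rightarrow> (nat \<Rightarrow> real ^ 3) \<Rightarrow> nat \<Rightarrow> complex" where
  "mid_potential_trunc L b \<sigma> \<omega> m K N q r i =
     4 * complex_of_real pi *
       (\<Sum>j=1..N. complex_of_real (q j) *
          L (\<lambda>k. if norm k \<le> K then mid_mode b \<sigma> \<omega> m (r i - r j) k else 0))"

text \<open>
  The Fourier transform of a Gaussian of width \<open>s\<close> decays like \<open>exp (- s^2 * k^2 / 4)\<close>. The self
  term \<open>j = i\<close> is not oscillating, so the truncation error at cutoff \<open>K\<close> is of order
  \<open>K * exp (- s^2 * K^2 / 4)\<close> with \<open>s\<close> the smallest width; the factor \<open>1 / 4\<close> cannot be dropped.
\<close>

definition mid_trunc_error ::
  "((real ^ 3 \<Rightarrow> complex) \<Rightarrow> complex) \<Rightarrow> real \<Rightarrow> real \<Rightarrow> real \<Rightarrow> nat \<Rightarrow> real \<Rightarrow>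
   nat \<Rightarrow> (nat \<Rightarrow> real) \<Rightarrow> (nat \<Rightarrow> real ^ 3) \<Rightarrow> nat \<Rightarrow> complex" where
  "mid_trunc_error L b \<sigma> \<omega> m K N q r i =
     mid_potential L b \<sigma> \<omega> m N q r i - mid_potential_trunc L b \<sigma> \<omega> m K N q r i"

definition mid_trunc_error_norm ::
  "((real ^ 3 \<Rightarrow> complex) \<Rightarrow> complex) \<Rightarrow> real \<Rightarrow> real \<Rightarrow> real \<Rightarrow> nat \<Rightarrow> real \<Rightarrow>
   nat \<Rightarrow> (nat \<Rightarrow> real) \<Rightarrow> (nat \<Rightarrow> real ^ 3) \<Rightarrow> real" where
  "mid_trunc_error_norm L b \<sigma> \<omega> m K N q r =
     (MAX i\<in>{1..N}. cmod (mid_trunc_error L b \<sigma> \<omega> m K N q r i))"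


section \<open>Charged systems and the Debye--Hueckel assumption\<close>

definition q_max :: "nat \<Rightarrow> (nat \<Rightarrow> real) \<Rightarrow> real" where
  "q_max N q = (MAX j\<in>{1..N}. \<bar>q j\<bar>)"

definition neutral_system ::
  "real \<Rightarrow> real \<Rightarrow> real \<Rightarrow> nat \<Rightarrow> (nat \<Rightarrow> real) \<Rightarrow> (nat \<Rightarrow> real ^ 3) \<Rightarrow> bool" where
  "neutral_system Lx Ly Lz N q r \<longleftrightarrow>
     Lx > 0 \<and> Ly > 0 \<and> Lz > 0 \<and> N \<ge> 1 \<and> (\<Sum>j=1..N. q j) = 0 \<and>
     (\<forall>i\<in>{1..N}. r i $ 1 \<in> {- Lx / 2..Lx / 2} \<and> r i $ 2 \<in> {- Ly / 2..Ly / 2} \<and>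
                 r i $ 3 \<in> {- Lz / 2..Lz / 2})"

definition poly_growth :: "(real \<Rightarrow> real) \<Rightarrow> bool" where
  "poly_growth G \<longleftrightarrow> (\<exists>c n. \<forall>x\<ge>0. \<bar>G x\<bar> \<le> c * (1 + x) ^ n)"

text \<open>
  Screening as provided by Debye--Hueckel theory for the sums around each ion. The constant
  \<open>C G\<close> depends on the radial function only; it is a parameter so that it can be chosen before
  the system. For one finite system alone some \<open>C\<close> always exists; the content of the assumption
  is that the bound does not depend on the number of particles, on their positions or on \<open>k\<close>.
  For \<open>G = 1\<close>, averaging over the directions of \<open>k\<close> gives the same bound for the sums with
  \<open>sin (k * r) / (k * r)\<close>.
\<close>

definition debye_hueckel ::
  "((real \<Rightarrow> real) \<Rightarrow> real) \<Rightarrow> nat \<Rightarrow> (nat \<Rightarrow> real) \<Rightarrow> (nat \<Rightarrow> real ^ 3) \<Rightarrow> bool" where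
  "debye_hueckel C N q r \<longleftrightarrow>
     (\<forall>G. poly_growth G \<longrightarrow>
       (\<forall>i\<in>{1..N}. \<forall>k :: real ^ 3.
          cmod (\<Sum>j=1..N. complex_of_real (q j) * exp (\<i> * complex_of_real (k \<bullet> (r i - r j))) *
                  complex_of_real (G (norm (r i - r j))))
          \<le> C G * q_max N q))"

end

theory Submission
  imports Defs "HOL-Real_Asymp.Real_Asymp"
begin

text \<open>
  With the sum over particles taken inside the Fourier integral, the Debye--Hueckel assumption for
  \<open>G = 1\<close> bounds the error by a constant times the tails \<open>|k| > K\<close> of the Gaussians with widths
  \<open>s\<^sub>l\<close>. Since \<open>w\<^sub>l s\<^sub>l\<^sup>3\<close> is proportional to \<open>s\<^sub>l\<^sup>2\<close>, which cancels the factor \<open>1 / s\<^sub>l\<^sup>2\<close> of the tail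
  integral, each width contributes at most a constant times \<open>K exp (- s\<^sub>l\<^sup>2 K\<^sup>2 / 4)\<close>. As
  \<open>s\<^sub>l = b\<^sup>l s\<^sub>0\<close> and \<open>s\<^sub>0 K \<ge> 1\<close>, the contributions are dominated by a geometric series, uniformly
  in the number of Gaussians.
\<close>

section \<open>Radial Gaussian tails in three dimensions\<close>

text \<open>The exact shell volume would bring in \<open>x * (x ^ 3 - K ^ 3)\<close> against the
  Gaussian, which has no elementary antiderivative. The weight used here is a polynomial in
  \<open>u = x^2\<close>, so the integral has a closed form; \<open>cube_diff_le\<close> makes it a
  majorant of the shell volume.\<close>

lemma nn_integral_gaussian_moment_tail:
  fixes a K :: real
  assumes "a > 0" "K > 0"
  shows "(\<integral>\<^sup>+x\<in>{K..}. ennreal (2 * a * x * exp (- (a * x\<^sup>2)) * (x\<^sup>2 * (x\<^sup>2 - K\<^sup>2))) \<partial>lborel)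
    = ennreal ((K\<^sup>2 / a + 2 / a\<^sup>2) * exp (- (a * K\<^sup>2)))"
proof -
  \<comment> \<open>Repeated integration by parts in \<open>u = x^2\<close>: with
    \<open>p u = u^2 - K^2 * u\<close> the antiderivative is
    \<open>- exp (- a * u) * (p + p' / a + p'' / a^2)\<close>. At \<open>x = K\<close> the term
    \<open>p\<close> vanishes.\<close>
  define F where "F = (\<lambda>x. - exp (- (a * x\<^sup>2)) *
    (x ^ 4 - K\<^sup>2 * x\<^sup>2 + (2 * x\<^sup>2 - K\<^sup>2) / a + 2 / a\<^sup>2))"
  have "(\<integral>\<^sup>+x\<in>{K..}. ennreal (2 * a * x * exp (- (a * x\<^sup>2)) * (x\<^sup>2 * (x\<^sup>2 - K\<^sup>2))) \<partial>lborel)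
    = ennreal (0 - F K)"
  proof (rule nn_integral_FTC_atLeast)
    show "(F has_real_derivative
        2 * a * x * exp (- (a * x\<^sup>2)) * (x\<^sup>2 * (x\<^sup>2 - K\<^sup>2))) (at x)" for x
      unfolding F_def using assms
      by (auto intro!: derivative_eq_intros simp: field_simps power2_eq_square eval_nat_numeral)
    show "0 \<le> 2 * a * x * exp (- (a * x\<^sup>2)) * (x\<^sup>2 * (x\<^sup>2 - K\<^sup>2))" if "K \<le> x" for x
      using assms that power_mono[of K x 2] by auto
    show "(F \<longlongrightarrow> 0) at_top"
      unfolding F_def using assms by real_asymp
  qed measurable
  also have "0 - F K = (K\<^sup>2 / a + 2 / a\<^sup>2) * exp (- (a * K\<^sup>2))"
    by (simp add: F_def field_simps eval_nat_numeral)
  finally show ?thesis .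
qed

text \<open>The difference \<open>2 * (x ^ 3 - K ^ 3) \<le> 3 * x * (x^2 - K^2)\<close> factors as
  \<open>(x - K)^2 * (x + 2 * K) \<ge> 0\<close>; multiplying by \<open>K \<le> x\<close> makes the
  right side even in \<open>x\<close>. Both sides agree to first order at \<open>x = K\<close>, so
  the leading term \<open>K / a\<close> of the tail bound loses nothing.\<close>

lemma cube_diff_le:
  fixes K x :: real
  assumes "0 < K" "K \<le> x"
  shows "x ^ 3 - K ^ 3 \<le> 3 / (2 * K) * (x\<^sup>2 * (x\<^sup>2 - K\<^sup>2))"
proof -
  have "K\<^sup>2 \<le> x\<^sup>2"
    using assms by (intro power_mono) auto
  have "K\<^sup>2 \<le> x * K"
    using assms by (simp add: power2_eq_square)
  with \<open>K\<^sup>2 \<le> x\<^sup>2\<close> have "0 \<le> (x - K) * (x\<^sup>2 + x * K - 2 * K\<^sup>2)"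
    using assms by (intro mult_nonneg_nonneg) linarith+
  then have "2 * (x ^ 3 - K ^ 3) \<le> 3 * (x * (x\<^sup>2 - K\<^sup>2))"
    by (simp add: algebra_simps eval_nat_numeral)
  then have "K * (2 * (x ^ 3 - K ^ 3)) \<le> K * (3 * (x * (x\<^sup>2 - K\<^sup>2)))"
    using assms by (intro mult_left_mono) auto
  then have "2 * K * (x ^ 3 - K ^ 3) \<le> 3 * (K * (x * (x\<^sup>2 - K\<^sup>2)))"
    by (simp only: mult_ac)
  also have "K * (x * (x\<^sup>2 - K\<^sup>2)) \<le> x * (x * (x\<^sup>2 - K\<^sup>2))"
    using assms \<open>K\<^sup>2 \<le> x\<^sup>2\<close> by (intro mult_right_mono) auto
  finally show ?thesis
    using assms by (simp add: field_simps power2_eq_square)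
qed

text \<open>
  Layer-cake argument: the Gaussian is the integral of minus its radial derivative, and the
  shells of outer radius \<open>x\<close> have volume proportional to \<open>x\<^sup>3 - K\<^sup>3\<close>.
\<close>

lemma nn_integral_gaussian_tail:
  fixes a K :: real
  assumes a: "a > 0" and K: "K > 0"
  shows "(\<integral>\<^sup>+k\<in>{k :: real ^ 3. K < norm k}. ennreal (exp (- (a * (norm k)\<^sup>2))) \<partial>lborel)
    \<le> ennreal (3 / 2 * unit_ball_vol 3 * (K / a + 2 / (a\<^sup>2 * K)) * exp (- (a * K\<^sup>2)))"
proof -
  define g where "g = (\<lambda>x. 2 * a * x * exp (- (a * x\<^sup>2)))"
  define c where "c = unit_ball_vol 3"
  have [measurable]: "g \<in> borel_measurable borel"
    unfolding g_def by measurable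
  have g_nonneg: "g x \<ge> 0" if "x \<ge> 0" for x
    using that a by (simp add: g_def)
  have c: "c \<ge> 0" by (simp add: c_def)
  have layer: "ennreal (exp (- (a * y\<^sup>2))) = (\<integral>\<^sup>+x. ennreal (g x) * indicator {y..} x \<partial>lborel)"
    if "y \<ge> 0" for y
  proof -
    have "(\<integral>\<^sup>+x. ennreal (g x) * indicator {y..} x \<partial>lborel) = ennreal (0 - (- exp (- (a * y\<^sup>2))))"
    proof (rule nn_integral_FTC_atLeast)
      show "((\<lambda>x. - exp (- (a * x\<^sup>2))) has_real_derivative g x) (at x)" for x
        unfolding g_def by (auto intro!: derivative_eq_intros)
      show "((\<lambda>x. - exp (- (a * x\<^sup>2))) \<longlongrightarrow> 0) at_top"
        using a by real_asymp
    qed (use that g_nonneg in auto)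
    then show ?thesis by simp
  qed
  have shell: "emeasure lborel {k :: real ^ 3. K < norm k \<and> norm k \<le> x}
      = ennreal (c * (x ^ 3 - K ^ 3))" if "K \<le> x" for x
  proof -
    have "{k :: real ^ 3. K < norm k \<and> norm k \<le> x} = cball 0 x - cball 0 K"
      by auto
    moreover have "emeasure lborel (cball 0 x - cball 0 K :: (real ^ 3) set)
        = emeasure lborel (cball 0 x :: (real ^ 3) set) - emeasure lborel (cball 0 K :: (real ^ 3) set)"
      using that K by (intro emeasure_Diff) (auto simp: emeasure_cball)
    ultimately show ?thesis
      using that K by (simp add: emeasure_cball ennreal_minus c_def power3_eq_cube algebra_simps)
  qed
  have "(\<integral>\<^sup>+k\<in>{k :: real ^ 3. K < norm k}. ennreal (exp (- (a * (norm k)\<^sup>2))) \<partial>lborel)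
      = (\<integral>\<^sup>+k. (\<integral>\<^sup>+x. ennreal (g x) * indicator {norm k..} x *
          indicator {k :: real ^ 3. K < norm k} k \<partial>lborel) \<partial>lborel)"
    by (simp add: layer nn_integral_multc)
  also have "\<dots> = (\<integral>\<^sup>+k. (\<integral>\<^sup>+x. (if norm (k :: real ^ 3) \<le> x \<and> K < norm k then ennreal (g x) else 0)
      \<partial>lborel) \<partial>lborel)"
    by (intro nn_integral_cong) (auto simp: indicator_def)
  also have "\<dots> = (\<integral>\<^sup>+x. (\<integral>\<^sup>+k. (if norm (k :: real ^ 3) \<le> x \<and> K < norm k then ennreal (g x) else 0)
      \<partial>lborel) \<partial>lborel)"
    by (rule lborel_pair.Fubini') measurable
  also have "\<dots> = (\<integral>\<^sup>+x. (\<integral>\<^sup>+k. ennreal (g x) *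
      indicator {k :: real ^ 3. K < norm k \<and> norm k \<le> x} k \<partial>lborel) \<partial>lborel)"
    by (intro nn_integral_cong) (auto simp: indicator_def)
  also have "\<dots> = (\<integral>\<^sup>+x. ennreal (g x) *
      emeasure lborel {k :: real ^ 3. K < norm k \<and> norm k \<le> x} \<partial>lborel)"
    by (intro nn_integral_cong nn_integral_cmult_indicator) simp
  \<comment> \<open>The shell is empty for \<open>x < K\<close>; beyond \<open>K\<close> its volume
    is replaced by the majorant whose moment is explicit.\<close>
  also have "\<dots> \<le> (\<integral>\<^sup>+x. ennreal (3 / (2 * K) * c) *
      (ennreal (g x * (x\<^sup>2 * (x\<^sup>2 - K\<^sup>2))) * indicator {K..} x) \<partial>lborel)"
  proof (intro nn_integral_mono)
    fix x :: real
    show "ennreal (g x) * emeasure lborel {k :: real ^ 3. K < norm k \<and> norm k \<le> x}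
      \<le> ennreal (3 / (2 * K) * c) * (ennreal (g x * (x\<^sup>2 * (x\<^sup>2 - K\<^sup>2))) * indicator {K..} x)"
    proof (cases "K \<le> x")
      case True
      have "g x * (c * (x ^ 3 - K ^ 3)) \<le> g x * (c * (3 / (2 * K) * (x\<^sup>2 * (x\<^sup>2 - K\<^sup>2))))"
        using True K c by (intro mult_left_mono cube_diff_le g_nonneg) auto
      moreover have "g x \<ge> 0"
        using True K by (intro g_nonneg) auto
      ultimately show ?thesis
        using True K c
        by (auto simp: shell ac_simps simp flip: ennreal_mult' intro!: ennreal_leI)
    next
      case False
      then have "{k :: real ^ 3. K < norm k \<and> norm k \<le> x} = {}" by auto
      then show ?thesis by (simp only: emeasure_empty) simp
    qed
  qed
  also have "\<dots> = ennreal (3 / (2 * K) * c) * ennreal ((K\<^sup>2 / a + 2 / a\<^sup>2) * exp (- (a * K\<^sup>2)))"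
    using nn_integral_gaussian_moment_tail[OF a K]
    by (subst nn_integral_cmult) (simp_all add: g_def)
  also have "\<dots> = ennreal (3 / 2 * c * (K / a + 2 / (a\<^sup>2 * K)) * exp (- (a * K\<^sup>2)))"
    using a K c by (simp add: field_simps power2_eq_square flip: ennreal_mult')
  finally show ?thesis
    by (simp add: c_def)
qed

lemma set_lebesgue_integral_sum:
  fixes f :: "'i \<Rightarrow> 'a \<Rightarrow> 'b :: {banach, second_countable_topology}"
  assumes "\<And>i. i \<in> I \<Longrightarrow> set_integrable M A (f i)"
  shows "(LINT x:A|M. (\<Sum>i\<in>I. f i x)) = (\<Sum>i\<in>I. (LINT x:A|M. f i x))"
  using assms unfolding set_lebesgue_integral_def set_integrable_def scaleR_sum_right
  by (rule Bochner_Integration.integral_sum)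

lemma set_integrable_gaussian_tail:
  fixes a K :: real
  assumes "a > 0" "K > 0"
  shows "set_integrable lborel {k :: real ^ 3. K < norm k} (\<lambda>k. exp (- (a * (norm k)\<^sup>2)))"
  unfolding set_integrable_def
proof (rule integrableI_nonneg)
  have "(\<integral>\<^sup>+k. ennreal (indicator {k :: real ^ 3. K < norm k} k *\<^sub>R exp (- (a * (norm k)\<^sup>2))) \<partial>lborel)
      = (\<integral>\<^sup>+k\<in>{k :: real ^ 3. K < norm k}. ennreal (exp (- (a * (norm k)\<^sup>2))) \<partial>lborel)"
    by (intro nn_integral_cong) (auto simp: indicator_def)
  also have "\<dots> < \<infinity>"
    using nn_integral_gaussian_tail[OF assms] by (rule le_less_trans) simp
  finally show "(\<integral>\<^sup>+k. ennreal (indicator {k :: real ^ 3. K < norm k} k *\<^sub>R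
      exp (- (a * (norm k)\<^sup>2))) \<partial>lborel) < \<infinity>" .
qed auto

lemma set_lebesgue_integral_gaussian_tail:
  fixes a K :: real
  assumes "a > 0" "K > 0"
  shows "(LINT k:{k :: real ^ 3. K < norm k}|lborel. exp (- (a * (norm k)\<^sup>2)))
    \<le> 3 / 2 * unit_ball_vol 3 * (K / a + 2 / (a\<^sup>2 * K)) * exp (- (a * K\<^sup>2))"
    (is "?I \<le> ?B")
proof -
  have "ennreal ?I =
      (\<integral>\<^sup>+k. ennreal (indicator {k :: real ^ 3. K < norm k} k *\<^sub>R exp (- (a * (norm k)\<^sup>2))) \<partial>lborel)"
    unfolding set_lebesgue_integral_def
    using set_integrable_gaussian_tail[OF assms]
    by (intro nn_integral_eq_integral[symmetric]) (auto simp: set_integrable_def)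
  also have "\<dots> = (\<integral>\<^sup>+k\<in>{k :: real ^ 3. K < norm k}. ennreal (exp (- (a * (norm k)\<^sup>2))) \<partial>lborel)"
    by (intro nn_integral_cong) (auto simp: indicator_def)
  also have "\<dots> \<le> ennreal ?B"
    by (rule nn_integral_gaussian_tail[OF assms])
  finally show ?thesis
    using assms by (subst (asm) ennreal_le_iff) auto
qed

text \<open>The Gaussian is at most 1 on the unit ball, which has finite volume, and the tail bound
  covers the rest.\<close>

lemma integrable_gaussian:
  fixes a :: real
  assumes "a > 0"
  shows "integrable lborel (\<lambda>k :: real ^ 3. exp (- (a * (norm k)\<^sup>2)))"
proof (rule Bochner_Integration.integrable_bound)
  have "integrable lborel (indicator (cball 0 1) :: real ^ 3 \<Rightarrow> real)"
    by (intro integrable_real_indicator) (auto simp: emeasure_cball)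
  then show "integrable lborel (\<lambda>k :: real ^ 3. indicator (cball 0 1) k +
      indicator {k. 1 < norm k} k *\<^sub>R exp (- (a * (norm k)\<^sup>2)))"
    using set_integrable_gaussian_tail[of a 1] assms
    by (intro Bochner_Integration.integrable_add) (auto simp: set_integrable_def)
qed (use assms in \<open>auto simp: indicator_def\<close>)

section \<open>Weights and tails of the individual SOG Gaussians\<close>

lemma sog_s_pos: "b > 0 \<Longrightarrow> \<sigma> > 0 \<Longrightarrow> sog_s b \<sigma> l > 0"
  by (simp add: sog_s_def)

text \<open>The powers of \<open>b\<close> and \<sigma> cancel in the product of weight and width.
  The factor \<open>1 + \<bar>\<omega>\<bar>\<close> serves both the adjusted weight at
  \<open>l = 0\<close> and the regular ones, for either sign of \<omega>.\<close>

lemma abs_sog_w_mult_cube_le: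
  assumes "b > 1" "\<sigma> > 0"
  shows "\<bar>sog_w b \<sigma> \<omega> l\<bar> * sog_s b \<sigma> l ^ 3
    \<le> (1 + \<bar>\<omega>\<bar>) * sqrt 2 * (pi / 2) powr (- 1 / 2) * ln b * sog_s b \<sigma> l ^ 2"
proof -
  define p where "p = (pi / 2) powr (- 1 / 2)"
  have p: "p > 0" and p_eq: "p = (pi / 2) powr - (1 / 2)" by (simp_all add: p_def)
  have "ln b > 0" using assms by simp
  have "\<bar>sog_w b \<sigma> \<omega> l\<bar> \<le> (1 + \<bar>\<omega>\<bar>) * (p * ln b / (b ^ l * \<sigma>))"
    using assms p \<open>ln b > 0\<close>
    by (auto simp: sog_w_def abs_mult field_simps simp flip: p_eq intro!: mult_right_mono)
  then have "\<bar>sog_w b \<sigma> \<omega> l\<bar> * sog_s b \<sigma> l ^ 3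
      \<le> (1 + \<bar>\<omega>\<bar>) * (p * ln b / (b ^ l * \<sigma>)) * sog_s b \<sigma> l ^ 3"
    using assms sog_s_pos[of b \<sigma> l] by (intro mult_right_mono) auto
  also have "\<dots> = (1 + \<bar>\<omega>\<bar>) * sqrt 2 * p * ln b * sog_s b \<sigma> l ^ 2"
    using assms by (simp add: sog_s_def field_simps eval_nat_numeral)
  finally show ?thesis
    by (simp add: p_def)
qed

text \<open>The condition \<open>s0 * K \<ge> 1\<close> acts twice: it absorbs the lower-order term
  of the tail bound, and it turns the growth of \<open>b ^ (2 * l)\<close> in the exponent into
  geometric decay in \<open>l\<close>.\<close>

lemma gaussian_tail_sog_s_le:
  assumes "b > 1" "\<sigma> > 0" "K \<ge> 1 / sog_s b \<sigma> 0"
  shows "sog_s b \<sigma> l ^ 2 *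
      (LINT k:{k :: real ^ 3. K < norm k}|lborel. exp (- (sog_s b \<sigma> l ^ 2 / 4 * (norm k)\<^sup>2)))
    \<le> 54 * unit_ball_vol 3 * (K * exp (- (sog_s b \<sigma> 0 ^ 2 * K ^ 2 / 4))) * exp (- ((b\<^sup>2 - 1) / 4)) ^ l"
proof -
  define s0 where "s0 = sog_s b \<sigma> 0"
  define s where "s = sog_s b \<sigma> l"
  have s0: "s0 > 0" using assms sog_s_pos[of b \<sigma> 0] by (simp add: s0_def)
  have s_eq: "s = b ^ l * s0" by (simp add: s_def s0_def sog_s_def)
  have s: "s \<ge> s0" "s > 0" using assms s0 by (auto simp: s_eq)
  have K: "K > 0" using assms s0 by (smt (verit) s0_def divide_pos_pos)
  have "1 \<le> s0 * K" using assms s0 by (simp add: s0_def field_simps)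
  also have "s0 * K \<le> s * K" using s K by simp
  finally have "1 \<le> (s * K)\<^sup>2" by simp
  have "1 \<le> (s0 * K)\<^sup>2" using \<open>1 \<le> s0 * K\<close> by simp
  have "s\<^sup>2 * (LINT k:{k :: real ^ 3. K < norm k}|lborel. exp (- (s\<^sup>2 / 4 * (norm k)\<^sup>2)))
      \<le> s\<^sup>2 * (3 / 2 * unit_ball_vol 3 * (K / (s\<^sup>2 / 4) + 2 / ((s\<^sup>2 / 4)\<^sup>2 * K)) * exp (- (s\<^sup>2 / 4 * K\<^sup>2)))"
    using s K by (intro mult_left_mono set_lebesgue_integral_gaussian_tail) auto
  also have "\<dots> = 3 / 2 * unit_ball_vol 3 * (4 * K + 32 * K / (s * K)\<^sup>2) * exp (- (s\<^sup>2 / 4 * K\<^sup>2))"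
    using s K by (simp add: field_simps power2_eq_square)
  \<comment> \<open>The constant 54 is \<open>3 / 2 * (4 + 32)\<close>.\<close>
  also have "\<dots> \<le> 3 / 2 * unit_ball_vol 3 * (4 * K + 32 * K) * exp (- (s\<^sup>2 / 4 * K\<^sup>2))"
    using \<open>1 \<le> (s * K)\<^sup>2\<close> s K
    by (intro mult_right_mono mult_left_mono add_left_mono) (auto simp: divide_le_eq)
  also have "\<dots> = 54 * unit_ball_vol 3 * (K * exp (- (s\<^sup>2 / 4 * K\<^sup>2)))"
    by simp
  also have "\<dots> \<le> 54 * unit_ball_vol 3 * (K * (exp (- (s0\<^sup>2 * K\<^sup>2 / 4)) * exp (- ((b\<^sup>2 - 1) / 4)) ^ l))"
  proof -
    \<comment> \<open>Bernoulli bounds \<open>b ^ (2 * l)\<close> below linearly in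
      \<open>l\<close>, so the exponential becomes an \<open>l\<close>-th power.\<close>
    have "1 + real l * (b\<^sup>2 - 1) \<le> (1 + (b\<^sup>2 - 1)) ^ l"
      by (intro Bernoulli_inequality) simp
    then have "real l * (b\<^sup>2 - 1) \<le> (b ^ l)\<^sup>2 - 1"
      by (simp add: mult.commute flip: power_mult)
    also have "\<dots> = ((b ^ l)\<^sup>2 - 1) * 1" by simp
    also have "\<dots> \<le> ((b ^ l)\<^sup>2 - 1) * (s0 * K)\<^sup>2"
      using \<open>1 \<le> (s0 * K)\<^sup>2\<close> assms by (intro mult_left_mono) auto
    finally have "(s0 * K)\<^sup>2 + real l * (b\<^sup>2 - 1) \<le> (b ^ l)\<^sup>2 * (s0 * K)\<^sup>2"
      by (simp add: left_diff_distrib)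
    then have "((s0 * K)\<^sup>2 + real l * (b\<^sup>2 - 1)) / 4 \<le> (b ^ l)\<^sup>2 * (s0 * K)\<^sup>2 / 4"
      by (rule divide_right_mono) simp
    then have "s0\<^sup>2 * K\<^sup>2 / 4 + real l * ((b\<^sup>2 - 1) / 4) \<le> s\<^sup>2 / 4 * K\<^sup>2"
      by (simp only: s_eq power_mult_distrib add_divide_distrib times_divide_eq_left
          times_divide_eq_right mult.assoc)
    then have "exp (- (s\<^sup>2 / 4 * K\<^sup>2)) \<le> exp (- (s0\<^sup>2 * K\<^sup>2 / 4) + real l * (- ((b\<^sup>2 - 1) / 4)))"
      by simp
    then show ?thesis
      using K unfolding exp_add exp_of_nat_mult by (intro mult_left_mono) auto
  qed
  finally show ?thesis
    by (simp add: s_def s0_def mult.assoc)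
qed

section \<open>An integrable majorant of the Fourier modes\<close>

text \<open>This is \<open>tau_mid_hat\<close> with \<open>norm k ^ 2\<close> already cancelled and
  absolute values on the weights, since \<omega> may be negative.\<close>

definition mid_gaussian_sum :: "real \<Rightarrow> real \<Rightarrow> real \<Rightarrow> nat \<Rightarrow> real ^ 3 \<Rightarrow> real" where
  "mid_gaussian_sum b \<sigma> \<omega> m k = sqrt pi / 4 *
     (\<Sum>l\<le>m. \<bar>sog_w b \<sigma> \<omega> l\<bar> * sog_s b \<sigma> l ^ 3 * exp (- (sog_s b \<sigma> l ^ 2 / 4 * (norm k)\<^sup>2)))"

lemma mid_gaussian_sum_nonneg:
  assumes "b > 1" "\<sigma> > 0"
  shows "mid_gaussian_sum b \<sigma> \<omega> m k \<ge> 0"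
  using assms sog_s_pos[of b \<sigma>]
  by (auto simp: mid_gaussian_sum_def intro!: mult_nonneg_nonneg sum_nonneg less_imp_le[of 0 "sog_s _ _ _"])

lemma abs_tau_mid_hat_le:
  assumes "b > 1" "\<sigma> > 0"
  shows "\<bar>tau_mid_hat b \<sigma> \<omega> m k / norm k ^ 2\<bar> \<le> mid_gaussian_sum b \<sigma> \<omega> m k"
\<comment> \<open>At the origin the quotient is \<open>0 / 0 = 0\<close>, so the cancellation of
  \<open>norm k ^ 2\<close> fails and only nonnegativity of the majorant is used.\<close>
proof (cases "k = 0")
  case True
  then show ?thesis
    using mid_gaussian_sum_nonneg[OF assms, of \<omega> m 0] by simp
next
  case False
  have "tau_mid_hat b \<sigma> \<omega> m k / norm k ^ 2 = sqrt pi / 4 *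
     (\<Sum>l\<le>m. sog_w b \<sigma> \<omega> l * sog_s b \<sigma> l ^ 3 * exp (- (sog_s b \<sigma> l ^ 2 / 4 * (norm k)\<^sup>2)))"
    using False by (simp add: tau_mid_hat_def sum_divide_distrib sum_distrib_left mult_ac)
  then have "\<bar>tau_mid_hat b \<sigma> \<omega> m k / norm k ^ 2\<bar> = sqrt pi / 4 *
     \<bar>\<Sum>l\<le>m. sog_w b \<sigma> \<omega> l * sog_s b \<sigma> l ^ 3 * exp (- (sog_s b \<sigma> l ^ 2 / 4 * (norm k)\<^sup>2))\<bar>"
    by (simp only: abs_mult) simp
  also have "\<dots> \<le> mid_gaussian_sum b \<sigma> \<omega> m k"
    using assms sog_s_pos[of b \<sigma>] unfolding mid_gaussian_sum_def
    by (intro mult_left_mono order.trans[OF sum_abs] sum_mono) (auto simp: abs_mult power_abs less_imp_le)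
  finally show ?thesis .
qed

lemma integrable_mid_gaussian_sum:
  assumes "b > 1" "\<sigma> > 0"
  shows "integrable lborel (mid_gaussian_sum b \<sigma> \<omega> m)"
  unfolding mid_gaussian_sum_def
  using assms sog_s_pos[of b \<sigma>]
  by (intro Bochner_Integration.integrable_sum integrable_mult_right integrable_gaussian) auto

lemma integrable_mid_mode:
  assumes "b > 1" "\<sigma> > 0"
  shows "integrable lborel (mid_mode b \<sigma> \<omega> m x)"
proof (rule Bochner_Integration.integrable_bound[OF integrable_mid_gaussian_sum[OF assms]])
  show "mid_mode b \<sigma> \<omega> m x \<in> borel_measurable lborel"
    unfolding mid_mode_def tau_mid_hat_def by measurable
  show "AE k in lborel. norm (mid_mode b \<sigma> \<omega> m x k) \<le> norm (mid_gaussian_sum b \<sigma> \<omega> m k)"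
    using abs_tau_mid_hat_le[OF assms]
    by (intro AE_I2) (auto simp: mid_mode_def norm_mult norm_divide norm_power intro: order.trans[OF _ abs_ge_self])
qed

text \<open>Extending the finite sum over \<open>l\<close> to the full geometric series, whose ratio
  is below 1 because \<open>b > 1\<close>, gives a constant that involves neither \<open>m\<close>
  nor \<sigma>.\<close>

lemma set_integral_mid_gaussian_sum_le:
  assumes "b > 1" "\<sigma> > 0" "K \<ge> 1 / sog_s b \<sigma> 0"
  shows "(LINT k:{k :: real ^ 3. K < norm k}|lborel. mid_gaussian_sum b \<sigma> \<omega> m k)
    \<le> sqrt pi / 4 * ((1 + \<bar>\<omega>\<bar>) * sqrt 2 * (pi / 2) powr (- 1 / 2) * ln b) *
        (54 * unit_ball_vol 3) / (1 - exp (- ((b\<^sup>2 - 1) / 4))) *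
        (K * exp (- (sog_s b \<sigma> 0 ^ 2 * K ^ 2 / 4)))"
proof -
  define D where "D = (1 + \<bar>\<omega>\<bar>) * sqrt 2 * (pi / 2) powr (- 1 / 2) * ln b"
  define E where "E = 54 * unit_ball_vol 3 * (K * exp (- (sog_s b \<sigma> 0 ^ 2 * K ^ 2 / 4)))"
  define x where "x = exp (- ((b\<^sup>2 - 1) / 4))"
  define I where "I = (\<lambda>l. LINT k:{k :: real ^ 3. K < norm k}|lborel.
    exp (- (sog_s b \<sigma> l ^ 2 / 4 * (norm k)\<^sup>2)))"
  have s: "sog_s b \<sigma> l > 0" for l using assms by (intro sog_s_pos) auto
  have K: "K > 0" using assms s[of 0] by (smt (verit) divide_pos_pos)
  have D: "D \<ge> 0" using assms by (simp add: D_def)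
  have E: "E \<ge> 0" using K by (simp add: E_def)
  have tail: "set_integrable lborel {k :: real ^ 3. K < norm k}
      (\<lambda>k. exp (- (sog_s b \<sigma> l ^ 2 / 4 * (norm k)\<^sup>2)))" for l
    using s[of l] K by (intro set_integrable_gaussian_tail) auto
  have x: "0 < x" "x < 1" using assms by (auto simp: x_def)
  have I: "I l \<ge> 0" for l
    unfolding I_def set_lebesgue_integral_def by (intro Bochner_Integration.integral_nonneg) auto
  have "(LINT k:{k :: real ^ 3. K < norm k}|lborel. mid_gaussian_sum b \<sigma> \<omega> m k)
      = sqrt pi / 4 * (\<Sum>l\<le>m. \<bar>sog_w b \<sigma> \<omega> l\<bar> * sog_s b \<sigma> l ^ 3 * I l)"
    unfolding mid_gaussian_sum_def I_def
    by (subst set_integral_mult_right, subst set_lebesgue_integral_sum)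
       (simp_all only: set_integral_mult_right set_integrable_mult_right tail)
  also have "\<dots> \<le> sqrt pi / 4 * (D * E * (1 / (1 - x)))"
  proof (rule mult_left_mono)
    have "(\<Sum>l\<le>m. \<bar>sog_w b \<sigma> \<omega> l\<bar> * sog_s b \<sigma> l ^ 3 * I l)
        \<le> (\<Sum>l\<le>m. D * sog_s b \<sigma> l ^ 2 * I l)"
      using assms I unfolding D_def by (intro sum_mono mult_right_mono abs_sog_w_mult_cube_le)
    also have "\<dots> = (\<Sum>l\<le>m. D * (sog_s b \<sigma> l ^ 2 * I l))"
      by (simp add: mult.assoc)
    also have "\<dots> \<le> (\<Sum>l\<le>m. D * (E * x ^ l))"
      using assms D unfolding E_def x_def I_def by (intro sum_mono mult_left_mono gaussian_tail_sog_s_le)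
    also have "\<dots> = D * E * (\<Sum>l\<le>m. x ^ l)"
      by (simp add: sum_distrib_left mult.assoc)
    also have "\<dots> \<le> D * E * (\<Sum>l. x ^ l)"
      using x D E by (intro mult_left_mono sum_le_suminf summable_geometric) auto
    also have "(\<Sum>l. x ^ l) = 1 / (1 - x)"
      using x by (intro suminf_geometric) auto
    finally show "(\<Sum>l\<le>m. \<bar>sog_w b \<sigma> \<omega> l\<bar> * sog_s b \<sigma> l ^ 3 * I l) \<le> D * E * (1 / (1 - x))" .
  qed simp
  also have "\<dots> = sqrt pi / 4 * D * (54 * unit_ball_vol 3) / (1 - x) *
      (K * exp (- (sog_s b \<sigma> 0 ^ 2 * K ^ 2 / 4)))"
    by (simp add: E_def)
  finally show ?thesis
    by (simp only: D_def x_def)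
qed

section \<open>The truncation error under Debye--Hueckel screening\<close>

text \<open>The sum over particles must enter the integral before absolute values are taken: the
  radial factor is common to all \<open>j\<close>, and the remaining sum of phases is where the
  charges cancel. Bounding the particles one by one would give a constant growing with
  \<open>N\<close>.\<close>

lemma mid_trunc_error_bulk_eq:
  assumes "b > 1" "\<sigma> > 0"
  shows "mid_trunc_error bulk_functional b \<sigma> \<omega> m K N q r i =
    complex_of_real (4 * pi / (2 * pi) ^ 3) *
      (LINT k:{k. K < norm k}|lborel. complex_of_real (tau_mid_hat b \<sigma> \<omega> m k / norm k ^ 2) *
         (\<Sum>j=1..N. complex_of_real (q j) * exp (\<i> * complex_of_real (k \<bullet> (r i - r j)))))"
proof -
  define M where "M = (\<lambda>j. mid_mode b \<sigma> \<omega> m (r i - r j))"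
  have M: "integrable lborel (M j)" for j
    unfolding M_def by (rule integrable_mid_mode[OF assms])
  have M_tail: "set_integrable lborel {k. K < norm k} (M j)" for j
    unfolding set_integrable_def by (rule integrable_mult_indicator[OF _ M]) auto
  \<comment> \<open>Integrability of both pieces is essential: the Bochner integral of a
    nonintegrable function is 0 by default, and the difference of integrals would then say
    nothing.\<close>
  have M_cut: "integrable lborel (\<lambda>k. if norm k \<le> K then M j k else 0)" for j
  proof -
    have "integrable lborel (\<lambda>k. indicator {k. norm k \<le> K} k *\<^sub>R M j k)"
      by (rule integrable_mult_indicator[OF _ M]) auto
    then show ?thesis
      by (rule back_subst[where P = "integrable lborel"]) (auto simp: indicator_def)
  qed
  have diff: "(\<integral>k. M j k \<partial>lborel) - (\<integral>k. (if norm k \<le> K then M j k else 0) \<partial>lborel)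
      = (LINT k:{k. K < norm k}|lborel. M j k)" for j
    unfolding set_lebesgue_integral_def
    by (subst Bochner_Integration.integral_diff[OF M M_cut, symmetric])
       (auto intro!: Bochner_Integration.integral_cong simp: indicator_def)
  have "mid_trunc_error bulk_functional b \<sigma> \<omega> m K N q r i =
      4 * complex_of_real pi * (\<Sum>j=1..N. complex_of_real (q j) *
        (complex_of_real (1 / (2 * pi) ^ 3) * (LINT k:{k. K < norm k}|lborel. M j k)))"
    unfolding mid_trunc_error_def mid_potential_def mid_potential_trunc_def bulk_functional_def
      M_def[symmetric] diff[symmetric] right_diff_distrib sum_subtractf
    by (simp only: M_def)
  also have "\<dots> = complex_of_real (4 * pi / (2 * pi) ^ 3) *
      (\<Sum>j=1..N. complex_of_real (q j) * (LINT k:{k. K < norm k}|lborel. M j k))"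
    by (simp add: sum_distrib_left mult_ac)
  also have "(\<Sum>j=1..N. complex_of_real (q j) * (LINT k:{k. K < norm k}|lborel. M j k))
      = (LINT k:{k. K < norm k}|lborel. (\<Sum>j=1..N. complex_of_real (q j) * M j k))"
    by (subst set_lebesgue_integral_sum) (simp_all add: M_tail)
  also have "(\<lambda>k. \<Sum>j=1..N. complex_of_real (q j) * M j k) =
      (\<lambda>k. complex_of_real (tau_mid_hat b \<sigma> \<omega> m k / norm k ^ 2) *
         (\<Sum>j=1..N. complex_of_real (q j) * exp (\<i> * complex_of_real (k \<bullet> (r i - r j)))))"
    by (auto simp: M_def mid_mode_def sum_distrib_left mult_ac)
  finally show ?thesis .
qed

lemma debye_hueckel_structure_factor_le:
  assumes "debye_hueckel C N q r" "i \<in> {1..N}"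
  shows "cmod (\<Sum>j=1..N. complex_of_real (q j) * exp (\<i> * complex_of_real (k \<bullet> (r i - r j))))
    \<le> C (\<lambda>_. 1) * q_max N q"
proof -
  have "poly_growth (\<lambda>_. 1)"
    unfolding poly_growth_def by (intro exI[of _ 1] exI[of _ 0]) simp
  then show ?thesis
    using assms unfolding debye_hueckel_def by fastforce
qed

lemma cmod_mid_trunc_error_bulk_le:
  assumes "b > 1" "\<sigma> > 0" "debye_hueckel C N q r" "i \<in> {1..N}"
  shows "cmod (mid_trunc_error bulk_functional b \<sigma> \<omega> m K N q r i)
    \<le> 4 * pi / (2 * pi) ^ 3 * (C (\<lambda>_. 1) * q_max N q) *
        (LINT k:{k. K < norm k}|lborel. mid_gaussian_sum b \<sigma> \<omega> m k)"
proof -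
  define S where "S = (\<lambda>k. \<Sum>j=1..N. complex_of_real (q j) * exp (\<i> * complex_of_real (k \<bullet> (r i - r j))))"
  define H where "H = C (\<lambda>_. 1) * q_max N q"
  have S: "cmod (S k) \<le> H" for k
    unfolding S_def H_def using assms by (intro debye_hueckel_structure_factor_le)
  define f where "f = (\<lambda>k. indicat_real {k. K < norm k} k *\<^sub>R
    (complex_of_real (tau_mid_hat b \<sigma> \<omega> m k / norm k ^ 2) * S k))"
  define h where "h = (\<lambda>k. indicat_real {k. K < norm k} k *\<^sub>R (H * mid_gaussian_sum b \<sigma> \<omega> m k))"
  have f_le: "norm (f k) \<le> h k" for k
  proof -
    have "\<bar>tau_mid_hat b \<sigma> \<omega> m k / norm k ^ 2\<bar> * cmod (S k) \<le> mid_gaussian_sum b \<sigma> \<omega> m k * H"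
      using assms S by (intro mult_mono abs_tau_mid_hat_le mid_gaussian_sum_nonneg) auto
    then show ?thesis
      by (auto simp: f_def h_def indicator_def norm_mult norm_divide norm_power mult.commute)
  qed
  have "norm (integral\<^sup>L lborel f) \<le> (\<integral>k. norm (f k) \<partial>lborel)"
    by (rule integral_norm_bound)
  also have "\<dots> \<le> integral\<^sup>L lborel h"
  proof (rule integral_mono')
    show "integrable lborel h"
      unfolding h_def using integrable_mid_gaussian_sum[OF assms(1,2)]
      by (intro integrable_mult_indicator integrable_mult_right) auto
    \<comment> \<open>The sign of \<open>C\<close> is not assumed; nonnegativity follows because
      \<open>h\<close> dominates a norm.\<close>
    show "0 \<le> h k" for k
      using f_le[of k] norm_ge_zero[of "f k"] by linarith
  qed (rule f_le)
  also have "integral\<^sup>L lborel h = H * (LINT k:{k. K < norm k}|lborel. mid_gaussian_sum b \<sigma> \<omega> m k)"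
    unfolding h_def set_lebesgue_integral_def[symmetric] by simp
  finally have "norm (LINT k:{k. K < norm k}|lborel.
      complex_of_real (tau_mid_hat b \<sigma> \<omega> m k / norm k ^ 2) * S k)
    \<le> H * (LINT k:{k. K < norm k}|lborel. mid_gaussian_sum b \<sigma> \<omega> m k)"
    by (simp only: f_def set_lebesgue_integral_def)
  then show ?thesis
    unfolding mid_trunc_error_bulk_eq[OF assms(1,2)] norm_mult[of "of_real _"] norm_of_real
      S_def H_def mult.assoc[of "4 * pi / (2 * pi) ^ 3"]
    by (intro mult_mono) auto
qed


section \<open>From the error estimate to the cutoff for a given tolerance\<close>

text \<open>Half of the Gaussian exponent is spent on the linear prefactor, since
  \<open>t \<le> 2 * (1 + t^2 / 8) \<le> 2 * exp (t^2 / 8)\<close>.\<close>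

lemma mult_exp_neg_square_le:
  fixes t :: real
  shows "t * exp (- (t\<^sup>2 / 4)) \<le> 2 * exp (- (t\<^sup>2 / 8))"
proof -
  have "t \<le> 2 * (1 + t\<^sup>2 / 8)"
    using zero_le_power2[of "t - 2"] by (simp add: power2_diff)
  also have "\<dots> \<le> 2 * exp (t\<^sup>2 / 8)"
    by (intro mult_left_mono exp_ge_add_one_self) auto
  finally have "t * exp (- (t\<^sup>2 / 4)) \<le> 2 * exp (t\<^sup>2 / 8) * exp (- (t\<^sup>2 / 4))"
    by (intro mult_right_mono) auto
  also have "\<dots> = 2 * exp (- (t\<^sup>2 / 8))"
    by (simp flip: exp_add)
  finally show ?thesis .
qed

text \<open>\<open>A\<close> and \<open>B\<close> precede \<sigma>, \<open>Lz\<close>,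
  \<open>m\<close> and the particles, so the O-constants are uniform in all of these. The threshold
  \<open>\<epsilon>\<^sub>0\<close> comes after \<sigma>: the bound is \<open>A / s0\<close> times a
  function of \<open>s0 * K\<close>, so smallness of \<epsilon> is relative to
  \<open>s0 / A\<close>. The range \<open>K \<ge> 1 / s0\<close> is the asymptotic regime; as
  \<open>K\<close> tends to 0 the bound vanishes while the error need not.\<close>

theorem theorem4p2:
  fixes b \<omega> \<eta> Q :: real and C :: "(real \<Rightarrow> real) \<Rightarrow> real"
  assumes "b > 1" and "\<eta> > 0"
  shows
    "\<exists>A>0. \<exists>B>0. \<forall>\<sigma>>0. \<forall>Lz>0. \<forall>m.
       sog_s b \<sigma> m \<le> \<eta> * Lz \<and> \<eta> * Lz < sog_s b \<sigma> (Suc m) \<longrightarrow>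
       (\<exists>\<epsilon>\<^sub>0. 0 < \<epsilon>\<^sub>0 \<and> \<epsilon>\<^sub>0 < 1 \<and>
         (\<forall>Lx Ly N q r.
            neutral_system Lx Ly Lz N q r \<and> q_max N q \<le> Q \<and> debye_hueckel C N q r \<longrightarrow>
            (\<forall>K \<ge> 1 / sog_s b \<sigma> 0.
               mid_trunc_error_norm bulk_functional b \<sigma> \<omega> m K N q r
                 \<le> A * (K * exp (- (sog_s b \<sigma> 0 ^ 2 * K ^ 2 / 4)))) \<and>
            (\<forall>\<epsilon>. 0 < \<epsilon> \<and> \<epsilon> < \<epsilon>\<^sub>0 \<longrightarrow>
               (\<forall>K \<ge> B * (sqrt (ln (1 / \<epsilon>)) / sog_s b \<sigma> 0).
                  mid_trunc_error_norm bulk_functional b \<sigma> \<omega> m K N q r \<le> \<epsilon>))))"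
proof -
  define P where "P = sqrt pi / 4 * ((1 + \<bar>\<omega>\<bar>) * sqrt 2 * (pi / 2) powr (- 1 / 2) * ln b) *
        (54 * unit_ball_vol 3) / (1 - exp (- ((b\<^sup>2 - 1) / 4)))"
  define R where "R = 4 * pi / (2 * pi) ^ 3 * (\<bar>C (\<lambda>_. 1)\<bar> * \<bar>Q\<bar>)"
  \<comment> \<open>The summand 1 keeps \<open>A\<close> positive when \<open>R * P = 0\<close>, for
    instance for \<open>Q = 0\<close>; \<open>A\<close> is a divisor in the threshold for
    \<epsilon>.\<close>
  define A where "A = R * P + 1"
  have P: "P \<ge> 0"
    unfolding P_def using assms by (intro divide_nonneg_nonneg mult_nonneg_nonneg) auto
  have R: "R \<ge> 0" unfolding R_def by simp
  have A: "A > 0" using P R by (simp add: A_def add_nonneg_pos)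
  have est: "mid_trunc_error_norm bulk_functional b \<sigma> \<omega> m K N q r
      \<le> A * (K * exp (- (sog_s b \<sigma> 0 ^ 2 * K ^ 2 / 4)))"
    if \<sigma>: "\<sigma> > 0" and sys: "neutral_system Lx Ly Lz N q r" "q_max N q \<le> Q" "debye_hueckel C N q r"
      and K: "K \<ge> 1 / sog_s b \<sigma> 0" for \<sigma> Lx Ly Lz N q r m K
  proof -
    define E where "E = K * exp (- (sog_s b \<sigma> 0 ^ 2 * K ^ 2 / 4))"
    define I where "I = (LINT k:{k. K < norm k}|lborel. mid_gaussian_sum b \<sigma> \<omega> m k)"
    have "sog_s b \<sigma> 0 > 0" using assms \<sigma> by (intro sog_s_pos) auto
    then have "K > 0" using K by (smt (verit) divide_pos_pos)
    then have E: "E \<ge> 0" by (simp add: E_def)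
    have N: "N \<ge> 1" using sys by (simp add: neutral_system_def)
    \<comment> \<open>A first particle exists, so \<open>q_max\<close> is nonnegative and
      multiplying by it preserves inequalities.\<close>
    then have "\<bar>q 1\<bar> \<le> q_max N q"
      unfolding q_max_def by (intro Max_ge) auto
    then have "\<bar>C (\<lambda>_. 1)\<bar> * q_max N q \<le> \<bar>C (\<lambda>_. 1)\<bar> * \<bar>Q\<bar>" "C (\<lambda>_. 1) * q_max N q \<le> \<bar>C (\<lambda>_. 1)\<bar> * q_max N q"
      using sys by (auto intro!: mult_left_mono mult_right_mono)
    then have CQ: "C (\<lambda>_. 1) * q_max N q \<le> \<bar>C (\<lambda>_. 1)\<bar> * \<bar>Q\<bar>" by linarith
    have "I \<ge> 0"
      unfolding I_def set_lebesgue_integral_def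
      using mid_gaussian_sum_nonneg assms \<sigma> by (intro Bochner_Integration.integral_nonneg) auto
    have "I \<le> P * E"
      unfolding I_def P_def E_def using assms \<sigma> K by (intro set_integral_mid_gaussian_sum_le)
    have "cmod (mid_trunc_error bulk_functional b \<sigma> \<omega> m K N q r i) \<le> A * E" if "i \<in> {1..N}" for i
    proof -
      have "cmod (mid_trunc_error bulk_functional b \<sigma> \<omega> m K N q r i)
          \<le> 4 * pi / (2 * pi) ^ 3 * (C (\<lambda>_. 1) * q_max N q) * I"
        unfolding I_def using assms \<sigma> sys that by (intro cmod_mid_trunc_error_bulk_le)
      also have "\<dots> \<le> R * I"
        unfolding R_def using CQ \<open>I \<ge> 0\<close> by (intro mult_right_mono mult_left_mono) auto
      also have "\<dots> \<le> R * (P * E)"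
        using \<open>I \<le> P * E\<close> R by (intro mult_left_mono)
      also have "\<dots> \<le> A * E"
        using E by (simp add: A_def algebra_simps)
      finally show ?thesis .
    qed
    then show ?thesis
      unfolding mid_trunc_error_norm_def E_def[symmetric] using N by (subst Max_le_iff) auto
  qed
  \<comment> \<open>The factor 4 gives \<open>(s * K)^2 / 8 \<ge> 2 * ln (1 / \<epsilon>)\<close>,
    hence an exponential of at most \<open>\<epsilon>^2\<close>. One \<epsilon> absorbs the
    prefactor \<open>2 * A / s\<close>, as \<open>\<epsilon> < s / (2 * A)\<close>; the other is the
    tolerance.\<close>
  have tol: "A * (K * exp (- (s ^ 2 * K ^ 2 / 4))) \<le> \<epsilon> \<and> 1 / s \<le> K"
    if s: "s > 0" and \<epsilon>: "0 < \<epsilon>" "\<epsilon> < min (1 / 3) (s / (2 * A))"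
      and K: "K \<ge> 4 * (sqrt (ln (1 / \<epsilon>)) / s)" for s \<epsilon> K
  proof -
    \<comment> \<open>Here \<open>\<epsilon> < 1 / 3\<close> enters through
      \<open>exp 1 \<le> 3\<close>; the logarithm is then at least 1, which also puts
      \<open>K\<close> in the range of the error estimate.\<close>
    have "exp 1 < 1 / \<epsilon>"
      using \<epsilon> by (intro le_less_trans[OF exp_le]) (auto simp: field_simps)
    then have "1 \<le> ln (1 / \<epsilon>)"
      using \<epsilon> by (subst ln_ge_iff) auto
    then have "1 \<le> sqrt (ln (1 / \<epsilon>))" by simp
    moreover have sK: "4 * sqrt (ln (1 / \<epsilon>)) \<le> s * K"
      using K s by (simp add: field_simps)
    ultimately have "1 \<le> s * K" by linarith
    have "(4 * sqrt (ln (1 / \<epsilon>)))\<^sup>2 \<le> (s * K)\<^sup>2"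
      using sK \<open>1 \<le> sqrt (ln (1 / \<epsilon>))\<close> by (intro power_mono) auto
    then have "2 * ln (1 / \<epsilon>) \<le> (s * K)\<^sup>2 / 8"
      using \<open>1 \<le> ln (1 / \<epsilon>)\<close> by (simp add: power_mult_distrib)
    then have "exp (- ((s * K)\<^sup>2 / 8)) \<le> exp (ln \<epsilon> + ln \<epsilon>)"
      using \<epsilon> by (simp add: ln_div)
    also have "\<dots> = \<epsilon> * \<epsilon>"
      using \<epsilon> unfolding exp_add by simp
    finally have *: "exp (- ((s * K)\<^sup>2 / 8)) \<le> \<epsilon> * \<epsilon>" .
    have "A * (K * exp (- (s ^ 2 * K ^ 2 / 4))) = A / s * (s * K * exp (- ((s * K)\<^sup>2 / 4)))"
      using s by (simp add: power_mult_distrib)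
    also have "\<dots> \<le> A / s * (2 * exp (- ((s * K)\<^sup>2 / 8)))"
      using A s by (intro mult_left_mono mult_exp_neg_square_le) auto
    also have "\<dots> \<le> A / s * (2 * (\<epsilon> * \<epsilon>))"
      using A s * by (intro mult_left_mono) auto
    also have "\<dots> = \<epsilon> * (2 * A / s * \<epsilon>)" by simp
    also have "\<dots> \<le> \<epsilon> * 1"
      using A s \<epsilon> by (intro mult_left_mono) (auto simp: field_simps)
    finally show ?thesis
      using \<open>1 \<le> s * K\<close> s by (simp add: field_simps)
  qed
  show ?thesis
  proof (rule exI[of _ A], intro conjI A, rule exI[of _ 4], intro conjI allI impI)
    fix \<sigma> Lz :: real and m :: nat
    assume "\<sigma> > 0"
    define s where "s = sog_s b \<sigma> 0"
    have s: "s > 0" unfolding s_def using assms \<open>\<sigma> > 0\<close> by (intro sog_s_pos) auto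
    show "\<exists>\<epsilon>\<^sub>0. 0 < \<epsilon>\<^sub>0 \<and> \<epsilon>\<^sub>0 < 1 \<and>
         (\<forall>Lx Ly N q r.
            neutral_system Lx Ly Lz N q r \<and> q_max N q \<le> Q \<and> debye_hueckel C N q r \<longrightarrow>
            (\<forall>K \<ge> 1 / sog_s b \<sigma> 0.
               mid_trunc_error_norm bulk_functional b \<sigma> \<omega> m K N q r
                 \<le> A * (K * exp (- (sog_s b \<sigma> 0 ^ 2 * K ^ 2 / 4)))) \<and>
            (\<forall>\<epsilon>. 0 < \<epsilon> \<and> \<epsilon> < \<epsilon>\<^sub>0 \<longrightarrow>
               (\<forall>K \<ge> 4 * (sqrt (ln (1 / \<epsilon>)) / sog_s b \<sigma> 0).
                  mid_trunc_error_norm bulk_functional b \<sigma> \<omega> m K N q r \<le> \<epsilon>)))"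
      unfolding s_def[symmetric]
    proof (rule exI[of _ "min (1 / 3) (s / (2 * A))"], intro conjI allI impI; (elim conjE)?)
      fix Lx Ly N q r \<epsilon> K
      assume "neutral_system Lx Ly Lz N q r" "q_max N q \<le> Q" "debye_hueckel C N q r"
        "0 < \<epsilon>" "\<epsilon> < min (1 / 3) (s / (2 * A))" "4 * (sqrt (ln (1 / \<epsilon>)) / s) \<le> K"
      then show "mid_trunc_error_norm bulk_functional b \<sigma> \<omega> m K N q r \<le> \<epsilon>"
        using tol[OF s] est[OF \<open>\<sigma> > 0\<close>] unfolding s_def by (meson order.trans)
    qed (use s A est[OF \<open>\<sigma> > 0\<close>] in \<open>auto simp: s_def\<close>)
  qed simp
qed

end
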